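(* Let $n\ge 1$ and $0\le k\le\frac{n(n-1)}{2}$ be integers, and let $\mathcal{S}(k,n)=L(00\cdots 0,\,k,\,n,\,0)$ be the ordered list produced by the procedure Gen1_Gray called with parameters $(k,n,0)$. Then the list of permutations obtained by applying $\psi$ to the successive terms of $\mathcal{S}(k,n)$ is a list of all the permutations in $\mathfrak{S}_n$ with major index equal to $k$, each appearing exactly once, and two consecutive permutations $\sigma,\tau$ in this list differ by at most three transpositions, i.e. $\tau=\sigma\cdot\theta_1\cdots\theta_m$ for some $m\le 3$ and some transpositions $\theta_1,\ldots,\theta_m\in\mathfrak{S}_n$.
   Context: $\mathfrak{S}_n$ is the set of permutations of $\{1,\ldots,n\}$, with product $(\sigma\cdot\tau)(i)=\sigma(\tau(i))$. The major index of $\pi\in\mathfrak{S}_n$ is the sum of all $i$, $1\le i<n$, with $\pi_i>\pi_{i+1}$. A subexcedant sequence of length $n$ is a sequence $c_1c_2\ldots c_n$ of integers with $0\le c_i\le i-1$ for all $i$; its weight is $\sum_i c_i$. $S(n)$ is the set of subexcedant sequences of length $n$, and $S(k,n)$ the set of those of weight $k$. For $0\le k<u\le n$, let $[[u,k]]\in\mathfrak{S}_n$ be the permutation obtained from the identity by $k$ right circular shifts of its length-$u$ prefix: $[[u,k]](i)=u-k+i$ for $1\le i\le k$, $[[u,k]](i)=i-k$ for $k<i\le u$, and $[[u,k]](i)=i$ for $i>u$. The map $\psi:S(n)\to\mathfrak{S}_n$ is $$\psi(t_1t_2\ldots t_n)=[[n,t_n]]\cdot[[n-1,t_{n-1}]]\cdot\ldots\cdot[[2,t_2]]\cdot[[1,t_1]].$$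 Procedure Gen1_Gray. For a length-$n$ sequence $\boldsymbol{c}$, integers $k\ge 0$, $r$, and $d\in\{0,1\}$, $L(\boldsymbol{c},k,r,d)$ denotes the ordered list output by the call Gen1_Gray$(k,r,d)$ when the current sequence is $\boldsymbol{c}$. Write $\boldsymbol{c}+x\varepsilon_i$ for the sequence obtained from $\boldsymbol{c}$ by adding $x$ to its $i$-th entry. The list is defined recursively: - If $k=0$, then $L(\boldsymbol{c},k,r,d)$ is the one-element list $(\boldsymbol{c})$. - If $k>0$, put $r'=r-1$ if $c_r=r-1$ and $r'=r$ otherwise; $\ell=\min\{s : \frac{s(s-1)}{2}\ge k\}$; $e=k-\frac{(\ell-1)(\ell-2)}{2}$. - If $d=0$, $L(\boldsymbol{c},k,r,0)$ is the concatenation, in this order, of $L(\boldsymbol{c}+e\varepsilon_\ell,\,k-e,\,\ell,\,0)$ and then, for $i=\ell+1,\ldots,r'$ (increasing), of $L(\boldsymbol{c}+\varepsilon_i,\,k-1,\,i,\,d_i)$, where $d_{\ell+1}=(r'-\ell)\bmod 2$ and the values $d_{\ell+1},d_{\ell+2},\ldots$ alternate between $0$ and $1$. - If $d=1$, $L(\boldsymbol{c},k,r,1)$ is the concatenation, in this order, for $i=r',r'-1,\ldots,\ell+1$ (decreasing), of $L(\boldsymbol{c}+\varepsilon_i,\,k-1,\,i,\,d_i)$, where $d_{r'}=0$ and the values $d_{r'},d_{r'-1},\ldots$ alternate between $0$ and $1$, followed by $L(\boldsymbol{c}+e\varepsilon_\ell,\,k-e,\,\ell,\,1)$. *)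

theory Defs
  imports "HOL-Combinatorics.Permutations"
begin

text \<open>
  Conventions: a sequence $c_1 \ldots c_n$ is a function \<open>c :: nat \<Rightarrow> nat\<close> of which only the
  entries \<open>c 1, \<dots>, c n\<close> matter; a permutation in $S_n$ is a function \<open>p\<close> with
  \<open>p permutes {1..n}\<close>, and the product of permutations is \<open>\<circ>\<close>.
\<close>

definition major_index :: "nat \<Rightarrow> (nat \<Rightarrow> nat) \<Rightarrow> nat" where
  "major_index n p = \<Sum>{i. 1 \<le> i \<and> i < n \<and> p i > p (i + 1)}"

text \<open>The permutation $[[u,k]]$, meant for \<open>0 \<le> k < u\<close>; it fixes \<open>0\<close> and everything above \<open>u\<close>.\<close>

definition prefix_shift :: "nat \<Rightarrow> nat \<Rightarrow> nat \<Rightarrow> nat" where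
  "prefix_shift u k i =
     (if 1 \<le> i \<and> i \<le> k then u - k + i
      else if k < i \<and> i \<le> u then i - k
      else i)"

primrec psi :: "nat \<Rightarrow> (nat \<Rightarrow> nat) \<Rightarrow> (nat \<Rightarrow> nat)" where
  "psi 0 t = id"
| "psi (Suc n) t = prefix_shift (Suc n) (t (Suc n)) \<circ> psi n t"

definition gray_l :: "nat \<Rightarrow> nat" where
  "gray_l k = (LEAST s. s * (s - 1) div 2 \<ge> k)"

definition gray_e :: "nat \<Rightarrow> nat" where
  "gray_e k = k - (gray_l k - 1) * (gray_l k - 2) div 2"

definition gray_r :: "(nat \<Rightarrow> nat) \<Rightarrow> nat \<Rightarrow> nat" where
  "gray_r c r = (if c r = r - 1 then r - 1 else r)"

definition add_at :: "(nat \<Rightarrow> nat) \<Rightarrow> nat \<Rightarrow> nat \<Rightarrow> (nat \<Rightarrow> nat)" where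
  "add_at c x i = c(i := c i + x)"

lemma gray_e_pos:
  assumes "0 < k"
  shows "0 < gray_e k"
proof -
  let ?P = "\<lambda>s::nat. s * (s - 1) div 2 \<ge> k"
  have "2 * k \<le> (2 * k) * (2 * k - 1)"
    using assms by (cases "2 * k - 1") auto
  hence "?P (2 * k)" by linarith
  hence P: "?P (gray_l k)"
    unfolding gray_l_def by (rule LeastI)
  hence "gray_l k \<noteq> 0" using assms by (intro notI) simp
  hence "\<not> ?P (gray_l k - 1)"
    unfolding gray_l_def by (intro not_less_Least) simp
  thus ?thesis
    unfolding gray_e_def by (simp add: numeral_2_eq_2)
qed

text \<open>
  The procedure \<open>Gen1_Gray\<close>. In the call with direction \<open>0\<close> the alternating values start with
  \<open>(r' - l) mod 2\<close> at index \<open>l + 1\<close>; in direction \<open>1\<close> they start with \<open>0\<close> at index \<open>r'\<close>.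
\<close>

function gen1_gray :: "(nat \<Rightarrow> nat) \<Rightarrow> nat \<Rightarrow> nat \<Rightarrow> nat \<Rightarrow> (nat \<Rightarrow> nat) list" where
  "gen1_gray c k r d =
     (if k = 0 then [c]
      else
        let r' = gray_r c r; l = gray_l k; e = gray_e k in
        if d = 0 then
          gen1_gray (add_at c e l) (k - e) l 0 @
          concat (map (\<lambda>i. gen1_gray (add_at c 1 i) (k - 1) i (((r' - l) + (i - (l + 1))) mod 2))
                      [l + 1..<r' + 1])
        else
          concat (map (\<lambda>i. gen1_gray (add_at c 1 i) (k - 1) i ((r' - i) mod 2))
                      (rev [l + 1..<r' + 1])) @
          gen1_gray (add_at c e l) (k - e) l 1)"
  by pat_completeness auto
termination
  by (relation "measure (\<lambda>(c, k, r, d). k)") (auto simp: gray_e_pos)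

declare gen1_gray.simps [simp del]

definition transposition_on :: "nat \<Rightarrow> (nat \<Rightarrow> nat) \<Rightarrow> bool" where
  "transposition_on n \<theta> \<longleftrightarrow>
     (\<exists>a b. a \<in> {1..n} \<and> b \<in> {1..n} \<and> a \<noteq> b \<and> \<theta> = Transposition.transpose a b)"

definition differ_by_at_most_transpositions ::
  "nat \<Rightarrow> nat \<Rightarrow> (nat \<Rightarrow> nat) \<Rightarrow> (nat \<Rightarrow> nat) \<Rightarrow> bool" where
  "differ_by_at_most_transpositions n m \<sigma> \<tau> \<longleftrightarrow>
     (\<exists>\<theta>s. length \<theta>s \<le> m \<and> (\<forall>\<theta>\<in>set \<theta>s. transposition_on n \<theta>) \<and>
           \<tau> = \<sigma> \<circ> foldr (\<circ>) \<theta>s id)"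

end

(*
  Writing [[u,k]] as the k-th power of a u-cycle, psi turns the weight of a subexcedant sequence
  into the major index: each unit shift of the values 1..u raises the major index by exactly one,
  as long as the value 1 is not in last position.

  Moving one unit from entry i to entry i+1 multiplies psi on the right by a single transposition,
  because [[i+1,1]] [[i,1]]^{-1} is the transposition (i i+1). So it suffices that consecutive
  sequences in the list are at most three such moves apart. The list in direction 1 is the reversal
  of the one in direction 0, and the latter starts with the greedy filling from the left. This
  determines both ends of every sublist, hence all transitions between neighbouring sublists.
*)

theory Submission
  imports Defs
begin

section \<open>Cyclic shifts with integer exponents\<close>

text \<open>A route of unit moves between two listed sequences may pass through sequences that are
  not subexcedant. The shifts are therefore taken as powers with arbitrary integer exponents, modulo
  the length of the cycle, so that every route is admissible and only its length matters.

  The bound 3 arises at one kind of boundary, that between the first block (entry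
  \<open>gray_l k = l\<close> receives \<open>gray_e k\<close> units) and the next one. Both terms
  that meet there are compared with the greedy filling. The left one has at most one unit moved from
  \<open>l - 1\<close> to \<open>l\<close>; the right one has at most one unit moved from
  \<open>l - 1\<close> to \<open>l\<close> and one or two from \<open>l\<close> to
  \<open>l + 1\<close>. The moves out of \<open>l - 1\<close> point the same way, so at most one of
  them survives in the difference. At the boundaries between later blocks \<open>i\<close> and
  \<open>i + 1\<close> two greedy starts or two final terms meet, and only one or two units move,
  all from \<open>i\<close> to \<open>i + 1\<close>.

  Completeness and absence of repetition are independent of the order: the blocks classify the
  sequences by the topmost entry that is raised.\<close>

definition cyc :: "nat \<Rightarrow> int \<Rightarrow> nat \<Rightarrow> nat" where
  "cyc u k i = (if 1 \<le> i \<and> i \<le> u then nat ((int i - 1 - k) mod int u) + 1 else i)"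

lemma cyc_range: "1 \<le> i \<Longrightarrow> i \<le> u \<Longrightarrow> cyc u k i \<in> {1..u}"
proof -
  assume a: "1 \<le> i" "i \<le> u"
  hence "(int i - 1 - k) mod int u < int u" "(int i - 1 - k) mod int u \<ge> 0" by simp_all
  hence "nat ((int i - 1 - k) mod int u) < u" by linarith
  thus ?thesis using a by (simp add: cyc_def)
qed

lemma cyc_add: "cyc u (a + b) = cyc u a \<circ> cyc u b"
proof
  fix i
  show "cyc u (a + b) i = (cyc u a \<circ> cyc u b) i"
  proof (cases "1 \<le> i \<and> i \<le> u")
    case True
    let ?m = "(int i - 1 - b) mod int u"
    have c: "cyc u b i = nat ?m + 1" using True by (simp add: cyc_def)
    have m: "0 \<le> ?m" using True by simp
    have r: "1 \<le> cyc u b i \<and> cyc u b i \<le> u" using cyc_range[of i u b] True by simp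
    have "(int (cyc u b i) - 1 - a) mod int u = (?m - a) mod int u"
      using c m by simp
    also have "\<dots> = (int i - 1 - (a + b)) mod int u"
      by (simp add: mod_diff_left_eq algebra_simps)
    finally show ?thesis using True r by (simp add: cyc_def)
  next
    case False
    then show ?thesis by (auto simp: cyc_def)
  qed
qed

lemma cyc_0 [simp]: "cyc u 0 = id"
  by (auto simp: cyc_def fun_eq_iff)

lemma cyc_permutes: "cyc u k permutes {1..u}"
proof (rule bij_imp_permutes)
  have inv: "cyc u k \<circ> cyc u (- k) = id" "cyc u (- k) \<circ> cyc u k = id"
    using cyc_add[of u k "- k"] cyc_add[of u "- k" k] by simp_all
  show "bij_betw (cyc u k) {1..u} {1..u}"
  proof (rule bij_betw_byWitness[where f' = "cyc u (- k)"])
    show "\<forall>a\<in>{1..u}. cyc u (- k) (cyc u k a) = a" "\<forall>a\<in>{1..u}. cyc u k (cyc u (- k) a) = a"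
      using inv by (simp_all add: fun_eq_iff)
    show "cyc u k ` {1..u} \<subseteq> {1..u}" "cyc u (- k) ` {1..u} \<subseteq> {1..u}"
      using cyc_range by auto
  qed
qed (auto simp: cyc_def)

lemma prefix_shift_eq_cyc: "k \<le> u \<Longrightarrow> prefix_shift u k = cyc u (int k)"
proof
  fix i
  assume k: "k \<le> u"
  consider "1 \<le> i \<and> i \<le> k" | "k < i \<and> i \<le> u" | "i = 0 \<or> i > u" by linarith
  then show "prefix_shift u k i = cyc u (int k) i"
  proof cases
    case 1
    have "(int i - 1 - int k) mod int u = (int i - 1 - int k + int u) mod int u" by simp
    also have "\<dots> = int i - 1 - int k + int u" using 1 k by (intro mod_pos_pos_trivial) auto
    finally have "(int i - 1 - int k) mod int u = int (u + i - k - 1)" using 1 k by simp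
    hence "nat ((int i - 1 - int k) mod int u) = u + i - k - 1" by (simp only: nat_int)
    then show ?thesis using 1 k by (simp add: prefix_shift_def cyc_def) arith
  next
    case 2
    have "(int i - 1 - int k) mod int u = int i - 1 - int k"
      using 2 k by (intro mod_pos_pos_trivial) auto
    then have "nat ((int i - 1 - int k) mod int u) = i - k - 1" using 2 by linarith
    then show ?thesis using 2 k by (simp add: prefix_shift_def cyc_def) arith
  qed (use k in \<open>auto simp: prefix_shift_def cyc_def\<close>)
qed

lemma cyc_1: "1 \<le> i \<Longrightarrow> i \<le> u \<Longrightarrow> cyc u 1 i = (if i = 1 then u else i - 1)"
  using prefix_shift_eq_cyc[of 1 u] by (auto simp: prefix_shift_def fun_eq_iff split: if_splits)

text \<open>\<open>cyc i (- 1)\<close> raises the values \<open>1..i\<close> and wraps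
  \<open>i\<close> to \<open>1\<close>; \<open>cyc (Suc i) 1\<close> lowers \<open>1..Suc i\<close>
  and wraps \<open>1\<close> to \<open>Suc i\<close>. The two wraps together send \<open>i\<close>
  to \<open>Suc i\<close>, the value \<open>Suc i\<close> is only lowered, and everything else
  returns to its place.\<close>

lemma cyc_Suc_1_comp_cyc_minus_1:
  assumes "1 \<le> i"
  shows "cyc (Suc i) 1 \<circ> cyc i (- 1) = Transposition.transpose i (Suc i)"
proof -
  have m: "cyc i (- 1) j = (if j = i then 1 else Suc j)" if "1 \<le> j" "j \<le> i" for j
    using that by (auto simp: cyc_def)
  have "(cyc (Suc i) 1 \<circ> cyc i (- 1)) j = Transposition.transpose i (Suc i) j" for j
  proof -
    consider "1 \<le> j \<and> j < i" | "j = i" | "j = Suc i" | "j = 0 \<or> j > Suc i" by linarith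
    then show ?thesis
    proof cases
      case 1
      then show ?thesis using m[of j] by (simp add: cyc_1 transpose_def)
    next
      case 2
      then show ?thesis using m[of j] assms by (simp add: cyc_1 transpose_def)
    next
      case 3
      have "cyc i (- 1) j = j" using 3 by (simp add: cyc_def)
      then show ?thesis using 3 assms by (simp add: cyc_1 transpose_def)
    next
      case 4
      then show ?thesis using assms by (auto simp: cyc_def transpose_def)
    qed
  qed
  then show ?thesis by (simp add: fun_eq_iff)
qed

primrec psi_int :: "nat \<Rightarrow> (nat \<Rightarrow> int) \<Rightarrow> (nat \<Rightarrow> nat)" where
  "psi_int 0 t = id"
| "psi_int (Suc n) t = cyc (Suc n) (t (Suc n)) \<circ> psi_int n t"

lemma psi_int_permutes: "psi_int n t permutes {1..n}"
proof (induction n)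
  case (Suc n)
  have "psi_int n t permutes {1..Suc n}" by (rule permutes_subset[OF Suc]) auto
  from permutes_compose[OF this cyc_permutes] show ?case by (simp only: psi_int.simps)
qed (simp add: permutes_empty id_def)

lemma psi_int_cong: "(\<And>j. 1 \<le> j \<Longrightarrow> j \<le> n \<Longrightarrow> t j = t' j) \<Longrightarrow> psi_int n t = psi_int n t'"
  by (induction n) auto

definition subexcedant :: "nat \<Rightarrow> (nat \<Rightarrow> nat) \<Rightarrow> bool" where
  "subexcedant n t \<longleftrightarrow> (\<forall>j\<le>n. t j \<le> j - 1)"

lemma psi_eq_psi_int: "subexcedant n t \<Longrightarrow> psi n t = psi_int n (\<lambda>j. int (t j))"
proof (induction n)
  case (Suc n)
  have "t (Suc n) \<le> Suc n" using Suc.prems by (force simp: subexcedant_def)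
  then show ?case using Suc by (simp add: prefix_shift_eq_cyc subexcedant_def)
qed simp

lemma psi_permutes: "subexcedant n t \<Longrightarrow> psi n t permutes {1..n}"
  by (metis psi_eq_psi_int psi_int_permutes)


section \<open>Transferring units between adjacent entries\<close>

lemma differ_by_refl: "differ_by_at_most_transpositions n m \<sigma> \<sigma>"
  unfolding differ_by_at_most_transpositions_def by (rule exI[of _ "[]"]) simp

lemma differ_by_mono:
  "differ_by_at_most_transpositions n m \<sigma> \<tau> \<Longrightarrow> m \<le> m' \<Longrightarrow> differ_by_at_most_transpositions n m' \<sigma> \<tau>"
  unfolding differ_by_at_most_transpositions_def using le_trans by blast

lemma foldr_comp_append: "foldr (\<circ>) (xs @ ys) id = foldr (\<circ>) xs id \<circ> foldr (\<circ>) ys id"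
  by (induction xs) (auto simp: comp_assoc)

lemma differ_by_trans:
  assumes "differ_by_at_most_transpositions n a \<rho> \<sigma>" "differ_by_at_most_transpositions n b \<sigma> \<tau>"
  shows "differ_by_at_most_transpositions n (a + b) \<rho> \<tau>"
proof -
  obtain xs ys where
    "length xs \<le> a" "\<forall>\<theta>\<in>set xs. transposition_on n \<theta>" "\<sigma> = \<rho> \<circ> foldr (\<circ>) xs id"
    "length ys \<le> b" "\<forall>\<theta>\<in>set ys. transposition_on n \<theta>" "\<tau> = \<sigma> \<circ> foldr (\<circ>) ys id"
    using assms unfolding differ_by_at_most_transpositions_def by blast
  then show ?thesis unfolding differ_by_at_most_transpositions_def
    by (intro exI[of _ "xs @ ys"]) (auto simp: foldr_comp_append comp_assoc simp del: foldr_append)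
qed

text \<open>Factors above \<open>Suc i\<close> multiply from the left and do not interfere, so the
  induction reduces to the two topmost factors. There the adjacent transposition appears in the
  middle of the product and still has to be carried to its right end.\<close>

lemma psi_int_transfer:
  assumes "1 \<le> i" "i < n"
  shows "\<exists>\<theta>. transposition_on n \<theta> \<and>
    psi_int n (t(i := t i - 1, Suc i := t (Suc i) + 1)) = psi_int n t \<circ> \<theta>"
  using assms
proof (induction n)
  case (Suc n)
  let ?t = "t(i := t i - 1, Suc i := t (Suc i) + 1)"
  show ?case
  proof (cases "i = n")
    case True
    obtain m where n: "n = Suc m" using True Suc.prems by (cases n) auto
    let ?f = "psi_int n t"
    have below: "psi_int m ?t = psi_int m t" using True n by (intro psi_int_cong) auto
    have e: "cyc n (t n - 1) = cyc n (- 1) \<circ> cyc n (t n)"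
            "cyc (Suc n) (t (Suc n) + 1) = cyc (Suc n) (t (Suc n)) \<circ> cyc (Suc n) 1"
      using cyc_add[of n "- 1" "t n"] cyc_add[of "Suc n" "t (Suc n)" 1] by simp_all
    have "psi_int (Suc n) ?t
        = cyc (Suc n) (t (Suc n)) \<circ> (cyc (Suc n) 1 \<circ> cyc n (- 1)) \<circ> (cyc n (t n) \<circ> psi_int m t)"
      using True n below e by (simp add: comp_assoc)
    also have "\<dots> = cyc (Suc n) (t (Suc n)) \<circ> (Transposition.transpose n (Suc n) \<circ> ?f)"
      using cyc_Suc_1_comp_cyc_minus_1[of n] Suc.prems True n by (simp add: comp_assoc)
    finally have *: "psi_int (Suc n) ?t =
      cyc (Suc n) (t (Suc n)) \<circ> (Transposition.transpose n (Suc n) \<circ> ?f)" .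
    have pf: "?f permutes {1..Suc n}"
      by (rule permutes_subset[OF psi_int_permutes]) auto
    \<comment> \<open>Conjugation by \<open>?f\<close> turns the exchange of the values
      \<open>n\<close> and \<open>Suc n\<close> into the exchange of the positions \<open>p\<close>
      and \<open>q\<close> that hold them.\<close>
    obtain p q where pq: "p \<in> {1..Suc n}" "q \<in> {1..Suc n}" "?f p = n" "?f q = Suc n"
    proof -
      have "n \<in> ?f ` {1..Suc n}" "Suc n \<in> ?f ` {1..Suc n}"
        using permutes_image[OF pf] Suc.prems True by auto
      then show ?thesis using that by (metis imageE)
    qed
    have "Transposition.transpose n (Suc n) \<circ> ?f = ?f \<circ> Transposition.transpose p q"
    proof
      fix x
      have "?f x = n \<longleftrightarrow> x = p" "?f x = Suc n \<longleftrightarrow> x = q"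
        using pq(3,4) permutes_inj[OF pf] by (metis inj_eq)+
      then show "(Transposition.transpose n (Suc n) \<circ> ?f) x = (?f \<circ> Transposition.transpose p q) x"
        using pq(3,4) by (auto simp: transpose_def)
    qed
    with * have "psi_int (Suc n) ?t = psi_int (Suc n) t \<circ> Transposition.transpose p q"
      by (simp add: comp_assoc)
    moreover have "p \<noteq> q" using pq by auto
    ultimately show ?thesis using pq(1,2) unfolding transposition_on_def by blast
  next
    case False
    then obtain \<theta> where "transposition_on n \<theta>" "psi_int n ?t = psi_int n t \<circ> \<theta>"
      using Suc.IH Suc.prems by (metis less_Suc_eq)
    moreover have "?t (Suc n) = t (Suc n)" using False Suc.prems by simp
    ultimately show ?thesis
      by (intro exI[of _ \<theta>]) (fastforce simp: transposition_on_def comp_assoc simp del: fun_upd_apply)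
  qed
qed simp

lemma transposition_involutive: "transposition_on n \<theta> \<Longrightarrow> \<theta> \<circ> \<theta> = id"
  by (auto simp: transposition_on_def)

lemma differ_by_1I:
  "transposition_on n \<theta> \<Longrightarrow> \<tau> = \<sigma> \<circ> \<theta> \<Longrightarrow> differ_by_at_most_transpositions n 1 \<sigma> \<tau>"
  unfolding differ_by_at_most_transpositions_def by (rule exI[of _ "[\<theta>]"]) simp

text \<open>Both directions are carried along because amounts may later be negative; a transposition
  is its own inverse, so each step can be undone at the same cost.\<close>

lemma differ_by_transfer_nat:
  assumes "1 \<le> i" "i < n"
  shows "differ_by_at_most_transpositions n m
           (psi_int n t) (psi_int n (t(i := t i - int m, Suc i := t (Suc i) + int m)))
       \<and> differ_by_at_most_transpositions n m
           (psi_int n (t(i := t i - int m, Suc i := t (Suc i) + int m))) (psi_int n t)"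
proof (induction m)
  case (Suc m)
  let ?t = "\<lambda>m. t(i := t i - int m, Suc i := t (Suc i) + int m)"
  have eq: "?t (Suc m) = (?t m)(i := ?t m i - 1, Suc i := ?t m (Suc i) + 1)"
    by (auto simp: fun_eq_iff)
  obtain \<theta> where th: "transposition_on n \<theta>" "psi_int n (?t (Suc m)) = psi_int n (?t m) \<circ> \<theta>"
    using psi_int_transfer[OF assms, of "?t m"] eq by metis
  hence "psi_int n (?t m) = psi_int n (?t (Suc m)) \<circ> \<theta>"
    using transposition_involutive[OF th(1)] by (simp add: comp_assoc)
  with th have "differ_by_at_most_transpositions n 1 (psi_int n (?t m)) (psi_int n (?t (Suc m)))"
    "differ_by_at_most_transpositions n 1 (psi_int n (?t (Suc m))) (psi_int n (?t m))"
    using differ_by_1I by blast+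
  then show ?case using Suc differ_by_trans by (metis Suc_eq_plus1 plus_1_eq_Suc)
qed (simp add: differ_by_refl)

lemma differ_by_transfer:
  assumes "1 \<le> i" "i < n"
  shows "differ_by_at_most_transpositions n (nat \<bar>a\<bar>)
           (psi_int n t) (psi_int n (t(i := t i - a, Suc i := t (Suc i) + a)))"
proof (cases "a \<ge> 0")
  case True
  then show ?thesis using differ_by_transfer_nat[OF assms, of "nat a" t] by simp
next
  case False
  let ?t = "t(i := t i - a, Suc i := t (Suc i) + a)"
  have "?t(i := ?t i - int (nat (- a)), Suc i := ?t (Suc i) + int (nat (- a))) = t"
    using False by (auto simp: fun_eq_iff)
  then show ?thesis using differ_by_transfer_nat[OF assms, of "nat (- a)" ?t] False by simp
qed

text \<open>The amounts \<open>a\<close> and \<open>b\<close> are transferred from entry \<open>i - 1\<close> to \<open>i\<close> and from \<open>i\<close> to \<open>i + 1\<close>.\<close>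

definition close :: "nat \<Rightarrow> (nat \<Rightarrow> nat) \<Rightarrow> (nat \<Rightarrow> nat) \<Rightarrow> bool" where
  "close n x y \<longleftrightarrow> (\<exists>i a b. 2 \<le> i \<and> i < n \<and> \<bar>a\<bar> + \<bar>b\<bar> \<le> 3 \<and>
     (\<forall>j. int (y j) = int (x j) +
       (if j = i - 1 then - a else if j = i then a - b else if j = i + 1 then b else 0)))"

lemma close_sym: "close n x y \<Longrightarrow> close n y x"
  unfolding close_def
proof (elim exE conjE)
  fix i and a b :: int
  assume "2 \<le> i" "i < n" "\<bar>a\<bar> + \<bar>b\<bar> \<le> 3" "\<forall>j. int (y j) = int (x j) +
       (if j = i - 1 then - a else if j = i then a - b else if j = i + 1 then b else 0)"
  then show "\<exists>i a b. 2 \<le> i \<and> i < n \<and> \<bar>a\<bar> + \<bar>b\<bar> \<le> 3 \<and> (\<forall>j. int (x j) = int (y j) +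
       (if j = i - 1 then - a else if j = i then a - b else if j = i + 1 then b else 0))"
    by (intro exI[of _ i] exI[of _ "- a"] exI[of _ "- b"]) auto
qed

lemma close_imp_differ_by:
  assumes "close n x y" "subexcedant n x" "subexcedant n y"
  shows "differ_by_at_most_transpositions n 3 (psi n x) (psi n y)"
proof -
  obtain i a b where i: "2 \<le> i" "i < n" and ab: "\<bar>a\<bar> + \<bar>b\<bar> \<le> 3"
    and y: "\<And>j. int (y j) = int (x j) +
       (if j = i - 1 then - a else if j = i then a - b else if j = i + 1 then b else 0)"
    using assms(1) unfolding close_def by blast
  define t where "t = (\<lambda>j. int (x j))"
  \<comment> \<open>Entry \<open>i\<close> of this intermediate sequence may be negative or exceed
    \<open>i - 1\<close>; only the two ends are subexcedant.\<close>
  define u where "u = t(i - 1 := t (i - 1) - a, Suc (i - 1) := t (Suc (i - 1)) + a)"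
  have yu: "(\<lambda>j. int (y j)) = u(i := u i - b, Suc i := u (Suc i) + b)"
    using y i by (auto simp: fun_eq_iff u_def t_def)
  have "differ_by_at_most_transpositions n (nat \<bar>a\<bar>) (psi_int n t) (psi_int n u)"
    unfolding u_def using i by (intro differ_by_transfer) auto
  moreover have "differ_by_at_most_transpositions n (nat \<bar>b\<bar>) (psi_int n u) (psi_int n (\<lambda>j. int (y j)))"
    unfolding yu using i by (intro differ_by_transfer) auto
  ultimately have "differ_by_at_most_transpositions n (nat \<bar>a\<bar> + nat \<bar>b\<bar>) (psi_int n t) (psi_int n (\<lambda>j. int (y j)))"
    by (rule differ_by_trans)
  then show ?thesis
    using ab assms(2,3) differ_by_mono[of n "nat \<bar>a\<bar> + nat \<bar>b\<bar>" _ _ 3]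
    by (simp add: psi_eq_psi_int t_def)
qed


section \<open>Major index of a permutation given by its code\<close>

text \<open>Only the value 1, at position \<open>m\<close>, changes its rank: it becomes the
  largest. Hence only positions \<open>m - 1\<close> and \<open>m\<close> can change status: a
  descent at \<open>m - 1\<close> turns into an ascent, and an ascent at \<open>m\<close> into a
  descent. The sum grows by \<open>m - (m - 1)\<close>. If 1 stood last, no descent would be
  gained.\<close>

lemma major_index_cyc_1:
  assumes p: "p permutes {1..N}" and N: "1 \<le> N" "p N \<noteq> 1"
  shows "major_index N (cyc N 1 \<circ> p) = major_index N p + 1"
proof -
  obtain m where m: "m \<in> {1..N}" "p m = 1"
    using permutes_image[OF p] N(1) by (metis atLeastAtMost_iff imageE order_refl)
  have mN: "m < N" using m N by (cases "m = N") auto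
  have rng: "1 \<le> p i \<and> p i \<le> N" if "1 \<le> i" "i \<le> N" for i
    using permutes_in_image[OF p, of i] that by auto
  have one: "p i = 1 \<longleftrightarrow> i = m" for i
    using permutes_inj[OF p] m by (metis inj_eq)
  define D where "D = {i. 1 \<le> i \<and> i < N \<and> p i > p (i + 1)}"
  define D' where "D' = {i. 1 \<le> i \<and> i < N \<and> (cyc N 1 \<circ> p) i > (cyc N 1 \<circ> p) (i + 1)}"
  have fin: "finite D" unfolding D_def by simp
  have val: "(cyc N 1 \<circ> p) i = (if i = m then N else p i - 1)" if "1 \<le> i" "i \<le> N" for i
    using rng[OF that] one[of i] by (auto simp: cyc_1)
  have "i \<in> D' \<longleftrightarrow> i \<in> insert m (D - {m - 1})" for i
  proof (cases "1 \<le> i \<and> i < N")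
    case True
    have v: "(cyc N 1 \<circ> p) i = (if i = m then N else p i - 1)"
      "(cyc N 1 \<circ> p) (i + 1) = (if i + 1 = m then N else p (i + 1) - 1)"
      using val True by auto
    have r: "1 \<le> p i" "p i \<le> N" "1 \<le> p (i + 1)" "p (i + 1) \<le> N"
      using rng True by auto
    consider "i = m" | "i + 1 = m" | "i \<noteq> m" "i + 1 \<noteq> m" by blast
    then show ?thesis
    proof cases
      case 1
      then show ?thesis using True v r by (auto simp: D'_def)
    next
      case 2
      hence m': "m = Suc i" by simp
      have "p (Suc i) = 1" using m(2) m' by simp
      then show ?thesis using True v r unfolding m' by (auto simp: D'_def D_def)
    next
      case 3
      hence "i \<noteq> m - 1" using True by linarith
      then show ?thesis using True v r 3 by (auto simp: D'_def D_def)
    qed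
  next
    case False
    then show ?thesis using m mN by (auto simp: D'_def D_def)
  qed
  hence D': "D' = insert m (D - {m - 1})" by blast
  have "m \<notin> D" using m rng[of "m + 1"] mN by (auto simp: D_def)
  hence "\<Sum>D' = m + \<Sum>(D - {m - 1})" using fin unfolding D' by simp
  \<comment> \<open>For \<open>m = 1\<close> nothing is removed, and the summand
    \<open>m - 1\<close> is 0, so the formula still holds.\<close>
  moreover have "\<Sum>D = (m - 1) + \<Sum>(D - {m - 1})"
  proof (cases "m = 1")
    case True
    then show ?thesis by (simp add: D_def)
  next
    case False
    have "1 \<le> m - 1" using False m(1) by auto
    moreover from this have "1 \<le> p (m - 1)" "p (m - 1) \<noteq> 1"
      using mN rng[of "m - 1"] one[of "m - 1"] by auto
    ultimately have "m - 1 \<in> D" using m(2) mN by (simp add: D_def)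
    then show ?thesis using fin by (simp add: sum.remove)
  qed
  ultimately show ?thesis using m(1) by (simp add: major_index_def D_def D'_def)
qed

lemma major_index_Suc:
  assumes "q permutes {1..n}"
  shows "major_index (Suc n) q = major_index n q"
proof -
  have "q (Suc n) = Suc n" using assms by (simp add: permutes_def)
  moreover have "q n \<le> n" 
    using permutes_in_image[OF assms, of n] permutes_not_in[OF assms, of n] by fastforce
  ultimately have "\<not> q n > q (Suc n)" by simp
  hence "{i. 1 \<le> i \<and> i < Suc n \<and> q i > q (i + 1)} = {i. 1 \<le> i \<and> i < n \<and> q i > q (i + 1)}"
    by (auto simp: less_Suc_eq)
  then show ?thesis by (simp add: major_index_def)
qed

text \<open>Since \<open>q\<close> fixes \<open>Suc n\<close>, the last position holds
  \<open>Suc n - k\<close> after \<open>k\<close> unit shifts. As long as \<open>k < n\<close> this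
  is not 1 and a further unit shift is covered by \<open>major_index_cyc_1\<close>.\<close>

lemma major_index_cyc:
  assumes q: "q permutes {1..n}" and "k \<le> n"
  shows "major_index (Suc n) (cyc (Suc n) (int k) \<circ> q) = major_index n q + k"
  using assms(2)
proof (induction k)
  case 0
  then show ?case using q by (simp add: major_index_Suc)
next
  case (Suc k)
  let ?p = "cyc (Suc n) (int k) \<circ> q"
  have eq: "cyc (Suc n) (int (Suc k)) \<circ> q = cyc (Suc n) 1 \<circ> ?p"
    using cyc_add[of "Suc n" 1 "int k"] by (simp add: comp_assoc)
  have p: "?p permutes {1..Suc n}"
    using permutes_compose[OF permutes_subset[OF q] cyc_permutes[of "Suc n"]] by auto
  have "q (Suc n) = Suc n" using q by (simp add: permutes_def)
  hence "?p (Suc n) = Suc n - k"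
    using Suc.prems prefix_shift_eq_cyc[of k "Suc n"]
    by (auto simp: prefix_shift_def simp flip: prefix_shift_eq_cyc)
  hence "?p (Suc n) \<noteq> 1" using Suc.prems by simp
  then show ?case unfolding eq using major_index_cyc_1[OF p] Suc by (simp del: o_apply add: comp_def)
qed

lemma major_index_psi: "subexcedant n t \<Longrightarrow> major_index n (psi n t) = sum t {..n}"
proof (induction n)
  case 0
  then show ?case by (simp add: major_index_def subexcedant_def)
next
  case (Suc n)
  have t: "subexcedant n t" "t (Suc n) \<le> n" using Suc.prems by (force simp: subexcedant_def)+
  then show ?case
    using Suc.IH major_index_cyc[OF psi_permutes[OF t(1)] t(2)]
    by (simp add: prefix_shift_eq_cyc comp_def)
qed

section \<open>Inverting psi: reading the code off the permutation\<close>

lemma psi_last: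
  assumes "subexcedant (Suc n) t"
  shows "psi (Suc n) t (Suc n) = Suc n - t (Suc n)"
proof -
  have t: "subexcedant n t" "t (Suc n) \<le> n" using assms by (force simp: subexcedant_def)+
  have "psi n t (Suc n) = Suc n" using psi_permutes[OF t(1)] by (simp add: permutes_def)
  then show ?thesis using t by (auto simp: prefix_shift_def)
qed

text \<open>By \<open>psi_last\<close> the last value of the permutation determines the last entry
  of the code; the outermost shift can then be cancelled.\<close>

lemma psi_inj:
  assumes "subexcedant n t" "subexcedant n t'" "psi n t = psi n t'" "j \<le> n"
  shows "t j = t' j"
  using assms
proof (induction n arbitrary: j)
  case 0
  then show ?case by (auto simp: subexcedant_def)
next
  case (Suc n)
  have t: "subexcedant n t" "subexcedant n t'" "t (Suc n) \<le> n" "t' (Suc n) \<le> n"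
    using Suc.prems by (force simp: subexcedant_def)+
  have eq: "t (Suc n) = t' (Suc n)"
    using psi_last[OF Suc.prems(1)] psi_last[OF Suc.prems(2)] t
    unfolding Suc.prems(3) by linarith
  have "inj (prefix_shift (Suc n) (t (Suc n)))"
    using permutes_inj[OF cyc_permutes] t by (simp add: prefix_shift_eq_cyc)
  hence "psi n t = psi n t'" using Suc.prems(3) eq by (simp add: fun_eq_iff inj_eq)
  then show ?case using Suc.IH t Suc.prems(4) eq by (cases "j = Suc n") auto
qed

lemma psi_cong: "(\<And>j. j \<le> n \<Longrightarrow> t j = t' j) \<Longrightarrow> psi n t = psi n t'"
  by (induction n) auto

text \<open>The last entry is dictated by \<open>psi_last\<close>, and undoing its shift leaves a
  permutation of \<open>{1..n}\<close>. Zeros beyond \<open>n\<close> are demanded because the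
  generated sequences vanish there, so that the code found is itself a term of the list.\<close>

lemma psi_surj:
  "p permutes {1..n} \<Longrightarrow> \<exists>t. subexcedant n t \<and> (\<forall>j>n. t j = 0) \<and> psi n t = p"
proof (induction n arbitrary: p)
  case 0
  then show ?case by (intro exI[of _ "\<lambda>_. 0"]) (auto simp: subexcedant_def)
next
  case (Suc n)
  have pn: "p (Suc n) \<in> {1..Suc n}" using permutes_in_image[OF Suc.prems] by simp
  define k where "k = Suc n - p (Suc n)"
  have k: "k \<le> n" "Suc n - k = p (Suc n)" using pn by (auto simp: k_def)
  define q where "q = cyc (Suc n) (- int k) \<circ> p"
  have q1: "q permutes {1..Suc n}"
    unfolding q_def using permutes_compose[OF Suc.prems cyc_permutes] .
  have pq: "p = cyc (Suc n) (int k) \<circ> q"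
    using cyc_add[of "Suc n" "int k" "- int k"] by (simp add: q_def comp_assoc[symmetric])
  have "cyc (Suc n) (int k) (Suc n) = p (Suc n)"
    using k prefix_shift_eq_cyc[of k "Suc n", symmetric] by (simp add: prefix_shift_def)
  hence "cyc (Suc n) (int k) (q (Suc n)) = cyc (Suc n) (int k) (Suc n)"
    using pq by (metis comp_apply)
  hence "q (Suc n) = Suc n" using permutes_inj[OF cyc_permutes] by (metis inj_eq)
  hence "q permutes {1..n}"
    using q1 by (intro permutes_superset[OF q1]) (auto simp: le_Suc_eq)
  then obtain t where t: "subexcedant n t" "psi n t = q" "\<forall>j>n. t j = 0" using Suc.IH by blast
  have "psi n (t(Suc n := k)) = q" using t(2) by (metis psi_cong fun_upd_other Suc_n_not_le_n)
  hence "psi (Suc n) (t(Suc n := k)) = p"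
    using k pq by (simp add: prefix_shift_eq_cyc)
  moreover have "subexcedant (Suc n) (t(Suc n := k))"
    using t k by (auto simp: subexcedant_def le_Suc_eq)
  ultimately show ?case using t(3) by (intro exI[of _ "t(Suc n := k)"] conjI) (assumption | simp)+
qed


section \<open>The order of the generated sequences\<close>

text \<open>The largest weight of a subexcedant sequence of length \<open>j\<close>. Thus
  \<open>gray_l k\<close> is the shortest length that can hold weight \<open>k\<close>.\<close>

definition tri :: "nat \<Rightarrow> nat" where
  "tri j = j * (j - 1) div 2"

lemma tri_0 [simp]: "tri 0 = 0" and tri_1 [simp]: "tri (Suc 0) = 0"
  by (simp_all add: tri_def)

lemma tri_Suc: "tri (Suc j) = tri j + j"
proof -
  have "Suc j * j = j * (j - 1) + j * 2" by (cases j) auto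
  then show ?thesis unfolding tri_def by simp
qed

lemma tri_pred: "0 < j \<Longrightarrow> tri j = tri (j - 1) + (j - 1)"
  using tri_Suc[of "j - 1"] by simp

lemma tri_mono: "i \<le> j \<Longrightarrow> tri i \<le> tri j"
  by (rule lift_Suc_mono_le) (auto simp: tri_Suc)

lemma le_tri_gray_l: "k \<le> tri (gray_l k)"
proof -
  have "k \<le> tri (Suc k)" by (simp add: tri_Suc)
  then show ?thesis unfolding gray_l_def tri_def by (rule LeastI)
qed

text \<open>A Galois connection: comparisons of positions with \<open>gray_l k\<close> become
  comparisons of weights, which arithmetic on \<open>tri\<close> can settle.\<close>

lemma gray_l_le_iff: "gray_l k \<le> i \<longleftrightarrow> k \<le> tri i"
proof
  show "gray_l k \<le> i \<Longrightarrow> k \<le> tri i" using le_tri_gray_l tri_mono le_trans by blast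
  show "k \<le> tri i \<Longrightarrow> gray_l k \<le> i" unfolding gray_l_def tri_def by (rule Least_le)
qed

lemma gray_l_ge_2: "0 < k \<Longrightarrow> 2 \<le> gray_l k"
  using gray_l_le_iff[of k 1] by simp

lemma tri_less_gray_l: "0 < k \<Longrightarrow> tri (gray_l k - 1) < k"
  using gray_l_le_iff[of k "gray_l k - 1"] gray_l_ge_2[of k] by linarith

lemma gray_e_eq: "gray_e k = k - tri (gray_l k - 1)"
  by (simp add: gray_e_def tri_def numeral_2_eq_2)

lemma gray_e_bounds:
  assumes "0 < k"
  shows "1 \<le> gray_e k" "gray_e k \<le> gray_l k - 1" "k = tri (gray_l k - 1) + gray_e k"
  using tri_less_gray_l[OF assms] le_tri_gray_l[of k] tri_pred[of "gray_l k"] gray_l_ge_2[OF assms]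
  by (simp_all add: gray_e_eq)

lemma minus_gray_e: "0 < k \<Longrightarrow> k - gray_e k = tri (gray_l k - 1)"
  using gray_e_bounds(3)[of k] by linarith

lemma gray_l_eqI: "tri (l - 1) < k \<Longrightarrow> k \<le> tri l \<Longrightarrow> gray_l k = l"
  using gray_l_le_iff[of k l] gray_l_le_iff[of k "l - 1"] by linarith

text \<open>The colexicographically least subexcedant sequence of weight \<open>k\<close>: it fills the entries
  greedily from the left. The outer subtraction truncates to \<open>0\<close> beyond entry \<open>gray_l k\<close>.\<close>

definition fill :: "nat \<Rightarrow> nat \<Rightarrow> nat" where
  "fill k j = min (j - 1) (k - tri (j - 1))"

lemma fill_0_left [simp]: "fill 0 = (\<lambda>_. 0)"
  by (simp add: fill_def fun_eq_iff)

lemma fill_eq: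
  assumes "0 < k"
  shows "fill k j = (if j < gray_l k then j - 1 else if j = gray_l k then gray_e k else 0)"
proof -
  consider "j < gray_l k" | "j = gray_l k" | "j > gray_l k" by linarith
  then show ?thesis
  proof cases
    case 1
    hence "tri j < k" using gray_l_le_iff[of k j] by simp
    moreover have "tri j = tri (j - 1) + (j - 1)" by (cases j) (auto simp: tri_Suc)
    ultimately show ?thesis using 1 by (simp add: fill_def)
  next
    case 2
    then show ?thesis using gray_e_bounds[OF assms] by (simp add: fill_def gray_e_eq)
  next
    case 3
    hence "k \<le> tri (j - 1)" using gray_l_le_iff[of k "j - 1"] by linarith
    then show ?thesis using 3 by (simp add: fill_def)
  qed
qed

lemma fill_tri: "fill (tri m) j = (if j \<le> m then j - 1 else 0)"
proof (cases "j \<le> m")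
  case True
  hence "tri j \<le> tri m" by (rule tri_mono)
  moreover have "tri j = tri (j - 1) + (j - 1)" by (cases j) (auto simp: tri_Suc)
  ultimately show ?thesis using True by (simp add: fill_def)
next
  case False
  then show ?thesis using tri_mono[of m "j - 1"] by (simp add: fill_def)
qed

text \<open>As a function of \<open>k\<close>, entry \<open>j\<close> is a ramp that climbs while
  \<open>k\<close> runs from \<open>tri (j - 1)\<close> to \<open>tri j\<close>. These intervals
  tile the weights, so each additional unit goes to exactly one entry.\<close>

lemma fill_Suc: "fill (Suc k) j = fill k j + (if j = gray_l (Suc k) then 1 else 0)"
proof -
  have t: "tri j = tri (j - 1) + (j - 1)" by (cases j) (auto simp: tri_Suc)
  have j: "j = gray_l (Suc k) \<longleftrightarrow> tri (j - 1) \<le> k \<and> k < tri (j - 1) + (j - 1)"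
    using t gray_l_le_iff[of "Suc k" j] gray_l_le_iff[of "Suc k" "j - 1"] gray_l_ge_2[of "Suc k"]
    by linarith
  have "min b (Suc k - a) = min b (k - a) + (if a \<le> k \<and> k < a + b then 1 else 0)" for a b
    by (auto simp: min_def)
  then show ?thesis unfolding j fill_def .
qed

section \<open>Reversal of direction, first and last terms of a list\<close>

lemma gray_0_left [simp]: "gen1_gray c 0 r d = [c]"
  by (simp add: gen1_gray.simps)

text \<open>The parity is counted down from \<open>gray_r c r\<close> instead of up from
  \<open>gray_l k + 1\<close>. In this form each block visibly has the direction opposite to its
  direction in a call with \<open>d = 1\<close>, and the block of \<open>gray_r c r\<close> always
  has direction 1.\<close>

lemma gray_0:
  assumes "0 < k"
  shows "gen1_gray c k r 0 =
    gen1_gray (add_at c (gray_e k) (gray_l k)) (k - gray_e k) (gray_l k) 0 @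
    concat (map (\<lambda>i. gen1_gray (add_at c 1 i) (k - 1) i ((gray_r c r - i + 1) mod 2))
                [gray_l k + 1..<gray_r c r + 1])"
proof -
  have *: "(gray_r c r - gray_l k + (i - (gray_l k + 1))) mod 2 = (gray_r c r - i + 1) mod 2"
    if "i \<in> set [gray_l k + 1..<gray_r c r + 1]" for i
  proof -
    define a where "a = i - (gray_l k + 1)"
    define b where "b = gray_r c r - i"
    have "gray_r c r - gray_l k + (i - (gray_l k + 1)) = b + 1 + 2 * a"
      using that by (auto simp: a_def b_def)
    then show ?thesis unfolding b_def by simp
  qed
  have "map (\<lambda>i. gen1_gray (add_at c 1 i) (k - 1) i
          ((gray_r c r - gray_l k + (i - (gray_l k + 1))) mod 2)) [gray_l k + 1..<gray_r c r + 1]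
      = map (\<lambda>i. gen1_gray (add_at c 1 i) (k - 1) i ((gray_r c r - i + 1) mod 2))
          [gray_l k + 1..<gray_r c r + 1]"
    by (rule map_cong[OF refl]) (simp only: *)
  then show ?thesis using assms
    by (subst gen1_gray.simps) (simp only: Let_def, simp del: upt_Suc)
qed

lemma gray_1_eq_rev: "gen1_gray c k r 1 = rev (gen1_gray c k r 0)"
proof (induction k arbitrary: c r rule: less_induct)
  case (less k)
  show ?case
  proof (cases "k = 0")
    case False
    hence k: "0 < k" by simp
    have swap: "gen1_gray c' (k - 1) i (m mod 2) = rev (gen1_gray c' (k - 1) i (Suc m mod 2))"
      for c' i m
    proof (cases "even m")
      case True
      then show ?thesis using less.IH[of "k - 1" c' i] k by (simp add: even_iff_mod_2_eq_zero mod_Suc)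
    next
      case False
      then show ?thesis using less.IH[of "k - 1" c' i] k by (simp add: odd_iff_mod_2_eq_one mod_Suc)
    qed
    have "gen1_gray c k r 1 =
      concat (map (\<lambda>i. gen1_gray (add_at c 1 i) (k - 1) i ((gray_r c r - i) mod 2))
        (rev [gray_l k + 1..<gray_r c r + 1])) @
      gen1_gray (add_at c (gray_e k) (gray_l k)) (k - gray_e k) (gray_l k) 1"
      using k by (subst gen1_gray.simps) (simp add: Let_def del: upt_Suc)
    also have "\<dots> = rev (gen1_gray c k r 0)"
      using less.IH[of "k - gray_e k"] gray_e_pos[OF k] k
      by (subst swap) (simp add: gray_0 rev_concat rev_map o_def del: upt_Suc)
    finally show ?thesis .
  qed simp
qed

lemma gray_not_Nil [simp]: "gen1_gray c k r 0 \<noteq> []"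
proof (induction k arbitrary: c r rule: less_induct)
  case (less k)
  then show ?case using gray_e_pos[of k] by (cases "k = 0") (auto simp: gray_0)
qed

lemma gray_mod_2_cases:
  obtains "gen1_gray c k r (m mod 2) = gen1_gray c k r 0" "even m"
  | "gen1_gray c k r (m mod 2) = rev (gen1_gray c k r 0)" "odd m"
  by (cases "even m") (use gray_1_eq_rev in \<open>auto simp: even_iff_mod_2_eq_zero odd_iff_mod_2_eq_one\<close>)

lemma hd_gray_0: "hd (gen1_gray c k r 0) = (\<lambda>j. c j + fill k j)"
proof (induction k arbitrary: c r rule: less_induct)
  case (less k)
  show ?case
  proof (cases "k = 0")
    case False
    hence k: "0 < k" by simp
    let ?l = "gray_l k"
    have "k - gray_e k = tri (?l - 1)" by (rule minus_gray_e[OF k])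
    hence "fill k j = (if j = ?l then gray_e k else 0) + fill (k - gray_e k) j" for j
      using fill_eq[OF k, of j] fill_tri[of "?l - 1" j] gray_l_ge_2[OF k] by auto
    then show ?thesis using k gray_e_pos[OF k] less.IH[of "k - gray_e k"]
      by (auto simp: gray_0 fun_eq_iff add_at_def)
  qed simp
qed

text \<open>The final block belongs to \<open>gray_r c r\<close> and has direction 1, so it ends
  with the greedy start of its reversal.\<close>

lemma last_gray_0_far:
  assumes "0 < k" "gray_l k < gray_r c r"
  shows "last (gen1_gray c k r 0) = (\<lambda>j. add_at c 1 (gray_r c r) j + fill (k - 1) j)"
proof -
  let ?r = "gray_r c r"
  have "[gray_l k + 1..<?r + 1] = [gray_l k + 1..<?r] @ [?r]"
    using assms(2) by simp
  hence "last (gen1_gray c k r 0) = last (gen1_gray (add_at c 1 ?r) (k - 1) ?r 1)"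
    using assms(1) by (simp add: gray_0 gray_1_eq_rev[simplified] del: upt_Suc)
  then show ?thesis by (simp only: gray_1_eq_rev last_rev hd_gray_0)
qed

lemma last_gray_0_near:
  assumes "0 < k" "gray_r c r \<le> gray_l k"
  shows "last (gen1_gray c k r 0) =
    last (gen1_gray (add_at c (gray_e k) (gray_l k)) (k - gray_e k) (gray_l k) 0)"
  using assms by (simp add: gray_0)

text \<open>No freedom is left: entry \<open>r\<close> is full and the remaining weight is the whole
  capacity below it. Each call with positive weight has only its first block, which is the same
  situation with \<open>r\<close> smaller by one.\<close>

lemma last_gray_0_full:
  assumes "\<forall>j<r. c j = 0" "c r = r - 1"
  shows "last (gen1_gray c (tri (r - 1)) r 0) = (\<lambda>j. c j + fill (tri (r - 1)) j)"
  using assms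
proof (induction r arbitrary: c)
  case (Suc r)
  show ?case
  proof (cases "tri r = 0")
    case False
    hence r: "r \<ge> 2" using tri_mono[of r 1] by (cases "r \<ge> 2") auto
    have l: "gray_l (tri r) = r" using r tri_pred[of r] by (intro gray_l_eqI) auto
    have e: "gray_e (tri r) = r - 1" using r tri_pred[of r] l by (simp add: gray_e_eq)
    have t: "tri r - (r - 1) = tri (r - 1)" using tri_pred[of r] r by simp
    have g: "gray_r c (Suc r) = r" using Suc.prems by (simp add: gray_r_def)
    have "last (gen1_gray c (tri r) (Suc r) 0) = last (gen1_gray (add_at c (r - 1) r) (tri (r - 1)) r 0)"
      using last_gray_0_near[of "tri r" c "Suc r"] False g l e t by simp
    also have "\<dots> = (\<lambda>j. add_at c (r - 1) r j + fill (tri (r - 1)) j)"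
      using Suc.prems by (intro Suc.IH) (auto simp: add_at_def)
    also have "\<dots> = (\<lambda>j. c j + fill (tri r) j)"
      using r by (auto simp: fun_eq_iff fill_tri add_at_def)
    finally show ?thesis by simp
  qed simp
qed simp

section \<open>Feasible states and the set of sequences listed\<close>

definition feasible :: "(nat \<Rightarrow> nat) \<Rightarrow> nat \<Rightarrow> nat \<Rightarrow> bool" where
  "feasible c k r \<longleftrightarrow> (\<forall>j<r. c j = 0) \<and> c r \<le> r - 1 \<and> k + c r \<le> tri r"

text \<open>Feasibility says that \<open>k\<close> fits into the room left up to entry
  \<open>r\<close>. If that entry is full, the room is at most \<open>tri (r - 1)\<close>, so the
  first block never raises a full entry.\<close>

lemma feasible_gray_l_le:
  assumes "feasible c k r" "0 < k"
  shows "gray_l k \<le> gray_r c r" "gray_r c r \<le> r" "gray_l k \<le> r"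
proof -
  have "gray_l k \<le> r" using assms by (auto simp: feasible_def gray_l_le_iff)
  moreover have "k \<le> tri (r - 1)" if "c r = r - 1"
    using assms that by (cases r) (auto simp: feasible_def tri_Suc)
  ultimately show "gray_l k \<le> gray_r c r" "gray_r c r \<le> r" "gray_l k \<le> r"
    by (auto simp: gray_r_def gray_l_le_iff)
qed

lemma feasible_step_l:
  assumes "feasible c k r" "0 < k"
  shows "feasible (add_at c (gray_e k) (gray_l k)) (k - gray_e k) (gray_l k)"
proof (cases "gray_l k = r")
  case True
  have "tri r = tri (r - 1) + (r - 1)"
    using True gray_l_ge_2[OF assms(2)] by (intro tri_pred) simp
  then have "c r + gray_e k \<le> r - 1"
    using assms gray_e_bounds[OF assms(2)] True unfolding feasible_def by auto
  then show ?thesis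
    using assms True gray_e_bounds[OF assms(2)] by (auto simp: feasible_def add_at_def)
next
  case False
  hence "gray_l k < r" using feasible_gray_l_le[OF assms] by simp
  hence "c (gray_l k) = 0" "\<forall>j<gray_l k. c j = 0" using assms by (auto simp: feasible_def)
  then show ?thesis
    using gray_e_bounds[OF assms(2)] le_tri_gray_l[of k] by (auto simp: feasible_def add_at_def)
qed

lemma feasible_step:
  assumes "feasible c k r" "0 < k" "gray_l k < i" "i \<le> gray_r c r"
  shows "feasible (add_at c 1 i) (k - 1) i"
proof (cases "i = r")
  case True
  hence "c r \<noteq> r - 1" using assms by (auto simp: gray_r_def)
  then show ?thesis using assms True by (auto simp: feasible_def add_at_def)
next
  case False
  hence "i < r" using feasible_gray_l_le[OF assms(1,2)] assms(4) by simp
  hence "c i = 0" "\<forall>j<i. c j = 0" using assms by (auto simp: feasible_def)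
  moreover have "k \<le> tri i" using assms gray_l_le_iff[of k i] by simp
  ultimately show ?thesis
    using gray_l_ge_2[OF assms(2)] assms(2,3) by (auto simp: feasible_def add_at_def)
qed

text \<open>The sequences listed by a call in a feasible state; entry \<open>r\<close> may already be partly filled.\<close>

definition completions :: "(nat \<Rightarrow> nat) \<Rightarrow> nat \<Rightarrow> nat \<Rightarrow> (nat \<Rightarrow> nat) set" where
  "completions c k r = {x. subexcedant r x \<and> c r \<le> x r \<and> (\<forall>j>r. x j = c j) \<and> sum x {..r} = k + c r}"

lemma subexcedant_sum_le: "subexcedant r x \<Longrightarrow> sum x {..r} \<le> tri r"
proof (induction r)
  case (Suc r)
  hence "subexcedant r x" "x (Suc r) \<le> r" by (force simp: subexcedant_def)+
  then show ?case using Suc.IH by (simp add: tri_Suc)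
qed (simp add: subexcedant_def)

lemma subexcedant_mono: "subexcedant r x \<Longrightarrow> i \<le> r \<Longrightarrow> subexcedant i x"
  by (simp add: subexcedant_def)

lemma sum_split_at: "i \<le> r \<Longrightarrow> sum x {..r} = sum x {..i} + sum x {i<..r}" for x :: "nat \<Rightarrow> nat"
  by (subst sum.union_disjoint[symmetric]) (auto intro!: sum.cong)

lemma sum_split_last: "0 < i \<Longrightarrow> sum x {..i} = sum x {..i - 1} + x i" for x :: "nat \<Rightarrow> nat"
  by (cases i) auto

lemma completions_0:
  assumes "feasible c 0 r"
  shows "completions c 0 r = {c}"
proof -
  have s: "sum x {..r} = x r + sum x {..<r}" for x :: "nat \<Rightarrow> nat"
    by (simp add: lessThan_Suc_atMost[symmetric])
  have "x = c" if x: "x \<in> completions c 0 r" for x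
  proof
    fix j
    have "x r + sum x {..<r} = c r" "c r \<le> x r"
      using x s[of x] by (simp_all add: completions_def)
    hence "x r = c r" "sum x {..<r} = 0" by linarith+
    hence "x r = c r" "\<And>j. j < r \<Longrightarrow> x j = 0" by auto
    then show "x j = c j" using x assms
      by (cases j r rule: linorder_cases) (auto simp: completions_def feasible_def)
  qed
  moreover have "c \<in> completions c 0 r"
    using assms s[of c] by (auto simp: completions_def subexcedant_def feasible_def le_less)
  ultimately show ?thesis by blast
qed

lemma completions_subset:
  assumes "feasible c k r" "i \<le> r" "x \<in> completions (add_at c m i) (k - m) i" "m \<le> k"
  shows "x \<in> completions c k r"
proof (cases "i = r")
  case True
  then show ?thesis using assms by (auto simp: completions_def add_at_def)
next
  case False
  hence i: "i < r" using assms by simp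
  have c0: "c i = 0" "\<And>j. i < j \<Longrightarrow> j < r \<Longrightarrow> c j = 0" "c r \<le> r - 1"
    using assms i by (auto simp: feasible_def)
  have x: "subexcedant i x" "\<And>j. j > i \<Longrightarrow> x j = c j" "sum x {..i} = k"
    using assms c0 by (auto simp: completions_def add_at_def)
  have "sum x {i<..r} = sum c {i<..r}" using x(2) by (intro sum.cong) auto
  also have "\<dots> = c r" using c0 i
    by (subst sum.remove[of _ r]) (auto intro!: sum.neutral)
  finally have "sum x {..r} = k + c r" using sum_split_at[of i r x] i x(3) by simp
  moreover have "subexcedant r x"
    unfolding subexcedant_def
  proof (intro allI impI)
    fix j assume "j \<le> r"
    then show "x j \<le> j - 1" using x(1,2) c0
      by (cases "j \<le> i"; cases "j = r") (auto simp: subexcedant_def)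
  qed
  ultimately show ?thesis using x(2) i by (auto simp: completions_def)
qed

text \<open>Take the topmost entry \<open>i\<close> where \<open>x\<close> exceeds \<open>c\<close>.
  All of the weight \<open>k\<close> lies at or below \<open>i\<close>, hence
  \<open>k \<le> tri i\<close>, which bounds \<open>i\<close> from below. If \<open>i = r\<close>,
  then \<open>c r < x r \<le> r - 1\<close>, so entry \<open>r\<close> was not full and
  \<open>gray_r c r = r\<close>.\<close>

lemma completions_top_entry:
  assumes f: "feasible c k r" and k: "0 < k" and x: "x \<in> completions c k r"
  obtains i where "gray_l k \<le> i" "i \<le> gray_r c r" "c i < x i" "\<And>j. i < j \<Longrightarrow> x j = c j"
    "sum x {..i} = k + c i"
proof -
  have xr: "subexcedant r x" "c r \<le> x r" "\<And>j. r < j \<Longrightarrow> x j = c j" "sum x {..r} = k + c r"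
    using x by (auto simp: completions_def)
  have ge: "c j \<le> x j" if "j \<le> r" for j
    using that xr(2) f by (cases "j = r") (auto simp: feasible_def)
  define A where "A = {j. j \<le> r \<and> c j < x j}"
  have fin: "finite A" unfolding A_def by simp
  have sumc: "sum c {..r} = c r"
    using f by (subst sum.remove[of _ r]) (auto simp: feasible_def intro!: sum.neutral)
  have "A \<noteq> {}"
  proof
    assume "A = {}"
    hence "sum x {..r} \<le> sum c {..r}" unfolding A_def by (intro sum_mono) (auto simp: not_less)
    then show False using sumc xr(4) k by simp
  qed
  define i where "i = Max A"
  have iA: "i \<in> A" unfolding i_def using fin \<open>A \<noteq> {}\<close> by (rule Max_in)
  have above: "x j = c j" if "i < j" for j
  proof (cases "j \<le> r")
    case True
    have "j \<notin> A" using that Max_ge[OF fin, of j] by (force simp: i_def)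
    then show ?thesis using True ge[of j] by (auto simp: A_def)
  qed (use xr(3) in auto)
  have ir: "i \<le> r" "c i < x i" using iA by (auto simp: A_def)
  have sumi: "sum x {..i} = k + c i"
  proof (cases "i = r")
    case False
    hence i: "i < r" using ir by simp
    have "sum x {i<..r} = sum c {i<..r}" using above by (intro sum.cong) auto
    also have "\<dots> = c r" using f i
      by (subst sum.remove[of _ r]) (auto simp: feasible_def intro!: sum.neutral)
    finally show ?thesis using sum_split_at[of i r x] ir i xr(4) f by (simp add: feasible_def)
  qed (use xr in auto)
  have "k \<le> tri i"
    using subexcedant_sum_le[OF subexcedant_mono[OF xr(1) ir(1)]] sumi by simp
  hence "gray_l k \<le> i" by (simp add: gray_l_le_iff)
  moreover have "i \<le> gray_r c r"
  proof (cases "i = r")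
    case True
    have "x r \<le> r - 1" using xr(1) by (simp add: subexcedant_def)
    then show ?thesis using True ir by (auto simp: gray_r_def)
  qed (use ir in \<open>auto simp: gray_r_def\<close>)
  ultimately show ?thesis using that ir(2) above sumi by blast
qed

text \<open>The blocks sort the completions by their topmost raised entry. Above
  \<open>gray_l k\<close> one unit suffices to mark it. At \<open>gray_l k\<close> the entries below
  hold at most \<open>tri (gray_l k - 1)\<close>, which forces at least \<open>gray_e k\<close>
  units there; this is why the first block adds them at once.\<close>

lemma completions_decompose:
  assumes f: "feasible c k r" and k: "0 < k"
  shows "completions c k r =
    completions (add_at c (gray_e k) (gray_l k)) (k - gray_e k) (gray_l k) \<union>
    (\<Union>i\<in>{gray_l k + 1..gray_r c r}. completions (add_at c 1 i) (k - 1) i)"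
proof (intro equalityI subsetI)
  fix x assume x: "x \<in> completions c k r"
  obtain i where i: "gray_l k \<le> i" "i \<le> gray_r c r" "c i < x i" "\<And>j. i < j \<Longrightarrow> x j = c j"
    "sum x {..i} = k + c i"
    using completions_top_entry[OF f k x] by blast
  have "i \<le> r" using i(2) feasible_gray_l_le[OF f k] by simp
  hence s: "subexcedant i x" using x by (auto simp: completions_def subexcedant_def)
  show "x \<in> completions (add_at c (gray_e k) (gray_l k)) (k - gray_e k) (gray_l k) \<union>
    (\<Union>i\<in>{gray_l k + 1..gray_r c r}. completions (add_at c 1 i) (k - 1) i)"
  proof (cases "i = gray_l k")
    case True
    have "sum x {..i - 1} \<le> tri (i - 1)"
      using s by (intro subexcedant_sum_le) (auto simp: subexcedant_def)
    hence "gray_e k + c i \<le> x i"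
      using gray_e_bounds[OF k] gray_l_ge_2[OF k] sum_split_last[of i x] i(5) True by simp
    then show ?thesis using True i s gray_e_bounds[OF k]
      by (auto simp: completions_def add_at_def)
  next
    case False
    then show ?thesis using i s k by (intro UnI2 UN_I[of i]) (auto simp: completions_def add_at_def)
  qed
next
  fix x assume "x \<in> completions (add_at c (gray_e k) (gray_l k)) (k - gray_e k) (gray_l k) \<union>
    (\<Union>i\<in>{gray_l k + 1..gray_r c r}. completions (add_at c 1 i) (k - 1) i)"
  then show "x \<in> completions c k r"
  proof (elim UnE UN_E)
    assume "x \<in> completions (add_at c (gray_e k) (gray_l k)) (k - gray_e k) (gray_l k)"
    then show ?thesis
      using completions_subset[OF f] feasible_gray_l_le[OF f k] gray_e_bounds(3)[OF k]
      by (metis le_add2)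
  next
    fix i assume "i \<in> {gray_l k + 1..gray_r c r}" "x \<in> completions (add_at c 1 i) (k - 1) i"
    then show ?thesis
      using completions_subset[OF f, of i x 1] feasible_gray_l_le[OF f k] k by simp
  qed
qed

lemma completions_disjoint:
  assumes "i < i'" "0 < m'"
  shows "completions (add_at c m i) k i \<inter> completions (add_at c m' i') k' i' = {}"
proof -
  have "x i' = c i'" if "x \<in> completions (add_at c m i) k i" for x
    using that assms by (auto simp: completions_def add_at_def)
  moreover have "x i' > c i'" if "x \<in> completions (add_at c m' i') k' i'" for x
    using that assms by (auto simp: completions_def add_at_def)
  ultimately show ?thesis by fastforce
qed

lemma set_gray_mod_2: "set (gen1_gray c k r (m mod 2)) = set (gen1_gray c k r 0)"
  by (rule gray_mod_2_cases[of c k r m]) auto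

lemma distinct_gray_mod_2: "distinct (gen1_gray c k r (m mod 2)) \<longleftrightarrow> distinct (gen1_gray c k r 0)"
  by (rule gray_mod_2_cases[of c k r m]) auto

lemma set_gray: "feasible c k r \<Longrightarrow> set (gen1_gray c k r 0) = completions c k r"
proof (induction k arbitrary: c r rule: less_induct)
  case (less k)
  show ?case
  proof (cases "k = 0")
    case True
    then show ?thesis using less.prems completions_0 by simp
  next
    case False
    hence k: "0 < k" by simp
    have 1: "set (gen1_gray (add_at c (gray_e k) (gray_l k)) (k - gray_e k) (gray_l k) 0) =
      completions (add_at c (gray_e k) (gray_l k)) (k - gray_e k) (gray_l k)"
      using less.IH[of "k - gray_e k"] feasible_step_l[OF less.prems k] gray_e_pos[OF k] k by simp
    have 2: "set (gen1_gray (add_at c 1 i) (k - 1) i 0) = completions (add_at c 1 i) (k - 1) i"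
      if "i \<in> {gray_l k + 1..gray_r c r}" for i
      using less.IH[of "k - 1"] feasible_step[OF less.prems k] that k by simp
    have "{gray_l k + 1..<gray_r c r + 1} = {gray_l k + 1..gray_r c r}" by auto
    then show ?thesis
      unfolding completions_decompose[OF less.prems k] gray_0[OF k] set_append set_concat
      using 1 2 by (simp add: set_gray_mod_2 del: upt_Suc)
  qed
qed

lemma distinct_concat_map_upt:
  assumes "\<And>i. a \<le> i \<Longrightarrow> i < b \<Longrightarrow> distinct (f i)"
    and "\<And>i j. a \<le> i \<Longrightarrow> i < j \<Longrightarrow> j < b \<Longrightarrow> set (f i) \<inter> set (f j) = {}"
  shows "distinct (concat (map f [a..<b]))"
  using assms
proof (induction b)
  case (Suc b)
  then show ?case by (cases "a \<le> b") (fastforce simp: upt_Suc_append)+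
qed simp

lemma distinct_gray: "feasible c k r \<Longrightarrow> distinct (gen1_gray c k r 0)"
proof (induction k arbitrary: c r rule: less_induct)
  case (less k)
  show ?case
  proof (cases "k = 0")
    case False
    hence k: "0 < k" by simp
    let ?l = "gray_l k" and ?r = "gray_r c r"
    let ?f = "\<lambda>i. gen1_gray (add_at c 1 i) (k - 1) i ((?r - i + 1) mod 2)"
    have fl: "feasible (add_at c (gray_e k) ?l) (k - gray_e k) ?l"
      by (rule feasible_step_l[OF less.prems k])
    have fi: "feasible (add_at c 1 i) (k - 1) i" if "?l < i" "i \<le> ?r" for i
      by (rule feasible_step[OF less.prems k that])
    have s: "set (?f i) = completions (add_at c 1 i) (k - 1) i" if "?l < i" "i \<le> ?r" for i
      by (simp only: set_gray_mod_2 set_gray[OF fi[OF that]])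
    have "distinct (concat (map ?f [?l + 1..<?r + 1]))"
    proof (rule distinct_concat_map_upt)
      show "distinct (?f i)" if "?l + 1 \<le> i" "i < ?r + 1" for i
        using less.IH[of "k - 1"] fi[of i] that k by (simp add: distinct_gray_mod_2)
      show "set (?f i) \<inter> set (?f j) = {}" if "?l + 1 \<le> i" "i < j" "j < ?r + 1" for i j
        using that s[of i] s[of j] completions_disjoint[of i j 1] by simp
    qed
    moreover have "distinct (gen1_gray (add_at c (gray_e k) ?l) (k - gray_e k) ?l 0)"
      using less.IH[of "k - gray_e k"] fl gray_e_pos[OF k] k by simp
    moreover have "set (gen1_gray (add_at c (gray_e k) ?l) (k - gray_e k) ?l 0) \<inter> set (?f i) = {}"
      if "?l < i" "i \<le> ?r" for i
      using that s[of i] set_gray[OF fl] completions_disjoint[of ?l i 1] by simp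
    moreover have "set [?l + 1..<?r + 1] = {i. ?l < i \<and> i \<le> ?r}" by auto
    ultimately show ?thesis unfolding gray_0[OF k] distinct_append set_concat set_map by blast
  qed simp
qed


section \<open>Transitions between neighbouring blocks\<close>

lemma fill_pred: "0 < k \<Longrightarrow> fill k j = fill (k - 1) j + (if j = gray_l k then 1 else 0)"
  using fill_Suc[of "k - 1" j] by simp

text \<open>If \<open>gray_e k\<close> fills entry \<open>gray_l k\<close>, the block consists of
  the greedy filling alone. Otherwise the last term puts one more unit into that entry and fills
  greedily with one unit less, and the missing unit is taken from the entry just below.\<close>

lemma last_first_block:
  assumes k: "0 < k" and c: "\<forall>j\<le>gray_l k. c j = 0"
  shows "int (last (gen1_gray (add_at c (gray_e k) (gray_l k)) (k - gray_e k) (gray_l k) 0) j) =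
    int (c j) + int (fill k j) +
    (if gray_e k = gray_l k - 1 then 0
     else if j = gray_l k then 1 else if j = gray_l k - 1 then - 1 else 0)"
proof -
  let ?l = "gray_l k" and ?e = "gray_e k"
  let ?c = "add_at c ?e ?l"
  have t: "k - ?e = tri (?l - 1)" by (rule minus_gray_e[OF k])
  have l2: "?l \<ge> 2" by (rule gray_l_ge_2[OF k])
  have split: "int (c j) + int (fill k j) = int (?c j) + int (fill (tri (?l - 1)) j)"
    using fill_eq[OF k, of j] fill_tri[of "?l - 1" j] l2 by (auto simp: add_at_def)
  show ?thesis
  proof (cases "?e = ?l - 1")
    case True
    have "last (gen1_gray ?c (tri (?l - 1)) ?l 0) = (\<lambda>j. ?c j + fill (tri (?l - 1)) j)"
      using c True by (intro last_gray_0_full) (auto simp: add_at_def)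
    then show ?thesis unfolding t split using True by simp
  next
    case False
    hence l3: "?l \<ge> 3" using gray_e_bounds[OF k] by simp
    have tp: "tri (?l - 1) = tri (?l - 1 - 1) + (?l - 1 - 1)" using l3 by (intro tri_pred) simp
    have lt: "gray_l (tri (?l - 1)) = ?l - 1" using l3 tp by (intro gray_l_eqI) auto
    have g: "gray_r ?c ?l = ?l" using c False by (simp add: gray_r_def add_at_def)
    have tpos: "0 < tri (?l - 1)" using tp l3 by simp
    have "last (gen1_gray ?c (tri (?l - 1)) ?l 0) = (\<lambda>j. add_at ?c 1 ?l j + fill (tri (?l - 1) - 1) j)"
      using last_gray_0_far[OF tpos, of ?c ?l] g lt l3 by simp
    then show ?thesis unfolding t split using False fill_pred[OF tpos, of j] lt l2
      by (auto simp: add_at_def)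
  qed
qed

text \<open>After one unit at \<open>gray_l k + 1\<close>, the last term depends on whether the next
  call has blocks beyond its first: if so, a second unit goes to its topmost admissible entry; if
  not, the problem is \<open>last_first_block\<close> for weight \<open>k - 1\<close>.\<close>

lemma last_second_block:
  assumes k: "0 < k" and c: "\<forall>j\<le>gray_l k. c j = 0"
  shows "\<exists>a b. a \<in> {0, 1} \<and> b \<in> {1, 2} \<and> (\<forall>j.
    int (last (gen1_gray (add_at c 1 (gray_l k + 1)) (k - 1) (gray_l k + 1) 0) j) =
    int (c j) + int (fill k j) +
    (if j = gray_l k - 1 then - a else if j = gray_l k then a - b else if j = gray_l k + 1 then b else 0))"
    (is "\<exists>a b. ?P a b")
proof -
  let ?l = "gray_l k" and ?e = "gray_e k"
  let ?c = "add_at c 1 (?l + 1)"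
  have l2: "?l \<ge> 2" by (rule gray_l_ge_2[OF k])
  note kb = gray_e_bounds[OF k]
  note fk = fill_pred[OF k]
  show ?thesis
  proof (cases "k = 1")
    case True
    have "?P 0 1" using fk True l2 by (auto simp: add_at_def)
    then show ?thesis by blast
  next
    case False
    hence k1: "0 < k - 1" using k by simp
    have l3: "?l \<ge> 3" using gray_l_le_iff[of k 2] k1 tri_Suc[of 1]
      by (simp add: numeral_2_eq_2 numeral_3_eq_3)
    define l' where "l' = gray_l (k - 1)"
    note fk1 = fill_pred[OF k1, folded l'_def]
    have tp: "tri (?l - 1) = tri (?l - 1 - 1) + (?l - 1 - 1)" using l3 by (intro tri_pred) simp
    \<comment> \<open>Taking one unit off the greedy filling empties entry \<open>?l\<close> exactly
      when it held a single unit.\<close>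
    have l'_cases: "(?e = 1 \<and> l' = ?l - 1) \<or> (?e \<ge> 2 \<and> l' = ?l)"
    proof (cases "?e = 1")
      case True
      then show ?thesis unfolding l'_def using kb tp l3
        by (intro disjI1 conjI gray_l_eqI) auto
    next
      case False
      then show ?thesis unfolding l'_def using kb le_tri_gray_l[of k]
        by (intro disjI2 conjI gray_l_eqI) auto
    qed
    define r' where "r' = gray_r ?c (?l + 1)"
    have r'_cases: "r' = ?l \<or> r' = ?l + 1" by (auto simp: r'_def gray_r_def)
    show ?thesis
    proof (cases "l' < r'")
      case True
      have last: "last (gen1_gray ?c (k - 1) (?l + 1) 0) = (\<lambda>j. add_at ?c 1 r' j + fill (k - 1 - 1) j)"
        using last_gray_0_far[OF k1] True unfolding l'_def r'_def by blast
      have fill: "fill k j = fill (k - 1 - 1) j + (if j = l' then 1 else 0) + (if j = ?l then 1 else 0)" for j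
        using fk[of j] fk1[of j] by simp
      consider "l' = ?l" "r' = ?l + 1" | "l' = ?l - 1" "r' = ?l + 1" | "l' = ?l - 1" "r' = ?l"
        using l'_cases r'_cases True by linarith
      \<comment> \<open>Compared with the greedy filling of weight \<open>k\<close>, units leave
        \<open>?l\<close> and \<open>l'\<close> and arrive at \<open>?l + 1\<close> and
        \<open>r'\<close>; this dictates both amounts.\<close>
      then have "?P (if l' = ?l then 0 else 1) (if r' = ?l then 1 else 2)"
        unfolding last fill by cases (use l3 in \<open>auto simp: add_at_def\<close>)
      then show ?thesis by blast
    next
      case False
      hence eq: "l' = ?l" "r' = ?l" "?e \<ge> 2" using l'_cases r'_cases l3 by auto
      have e': "gray_e (k - 1) = ?e - 1" using eq(1) unfolding gray_e_eq l'_def by simp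
      have last: "last (gen1_gray ?c (k - 1) (?l + 1) 0) =
        last (gen1_gray (add_at ?c (gray_e (k - 1)) l') (k - 1 - gray_e (k - 1)) l' 0)"
        unfolding l'_def using last_gray_0_near[OF k1] eq unfolding l'_def r'_def by simp
      have "\<forall>j\<le>gray_l (k - 1). ?c j = 0"
        using c eq(1) by (auto simp: l'_def add_at_def)
      note lb = last_first_block[OF k1 this, folded l'_def]
      \<comment> \<open>With one unit less, entry \<open>?l\<close> is not full, so the branch of
        \<open>last_first_block\<close> that moves a unit from \<open>?l - 1\<close> to
        \<open>?l\<close> applies.\<close>
      have "gray_e (k - 1) \<noteq> l' - 1" using e' eq kb(2) by linarith
      hence "?P 1 1"
        unfolding last lb fk using eq(1) l3 by (auto simp: add_at_def)
      then show ?thesis by blast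
    qed
  qed
qed

lemma hd_second_block:
  assumes k: "0 < k" and c: "\<forall>j\<le>gray_l k. c j = 0"
  shows "\<exists>a b. a \<in> {0, 1} \<and> b \<in> {1, 2} \<and> (\<forall>j.
    int (hd (gen1_gray (add_at c 1 (gray_l k + 1)) (k - 1) (gray_l k + 1) (m mod 2)) j) =
    int (c j) + int (fill k j) +
    (if j = gray_l k - 1 then - a else if j = gray_l k then a - b else if j = gray_l k + 1 then b else 0))"
proof (rule gray_mod_2_cases[of "add_at c 1 (gray_l k + 1)" "k - 1" "gray_l k + 1" m])
  assume eq: "gen1_gray (add_at c 1 (gray_l k + 1)) (k - 1) (gray_l k + 1) (m mod 2) =
    gen1_gray (add_at c 1 (gray_l k + 1)) (k - 1) (gray_l k + 1) 0"
  show ?thesis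
    unfolding eq hd_gray_0 using fill_pred[OF k] gray_l_ge_2[OF k]
    by (intro exI[of _ 0] exI[of _ 1]) (auto simp: add_at_def)
next
  assume eq: "gen1_gray (add_at c 1 (gray_l k + 1)) (k - 1) (gray_l k + 1) (m mod 2) =
    rev (gen1_gray (add_at c 1 (gray_l k + 1)) (k - 1) (gray_l k + 1) 0)"
  show ?thesis unfolding eq hd_rev by (rule last_second_block[OF assms])
qed

lemma close_first_second_block:
  assumes k: "0 < k" and c: "\<forall>j\<le>gray_l k. c j = 0" and n: "gray_l k < n"
  shows "close n
    (last (gen1_gray (add_at c (gray_e k) (gray_l k)) (k - gray_e k) (gray_l k) 0))
    (hd (gen1_gray (add_at c 1 (gray_l k + 1)) (k - 1) (gray_l k + 1) (m mod 2)))"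
proof -
  let ?l = "gray_l k"
  define s :: int where "s = (if gray_e k = ?l - 1 then 0 else 1)"
  obtain a b where ab: "a \<in> {0, 1}" "b \<in> {1, 2}"
    and y: "\<And>j. int (hd (gen1_gray (add_at c 1 (?l + 1)) (k - 1) (?l + 1) (m mod 2)) j) =
      int (c j) + int (fill k j) +
      (if j = ?l - 1 then - a else if j = ?l then a - b else if j = ?l + 1 then b else 0)"
    using hd_second_block[OF k c, of m] by blast
  have x: "int (last (gen1_gray (add_at c (gray_e k) ?l) (k - gray_e k) ?l 0) j) =
    int (c j) + int (fill k j) + (if j = ?l then s else if j = ?l - 1 then - s else 0)" for j
    unfolding last_first_block[OF k c] s_def by simp
  \<comment> \<open>Both \<open>a\<close> and \<open>s\<close> count units moved from
    \<open>?l - 1\<close> to \<open>?l\<close>, so they partly cancel: the first term is at most 1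
    rather than 2. Together with \<open>b \<le> 2\<close> this gives the bound 3.\<close>
  have "\<bar>a - s\<bar> + \<bar>b\<bar> \<le> 3" using ab by (auto simp: s_def)
  moreover have "2 \<le> ?l" by (rule gray_l_ge_2[OF k])
  ultimately show ?thesis unfolding close_def x y using n
    by (intro exI[of _ ?l] exI[of _ "a - s"] exI[of _ b]) auto
qed

text \<open>Directions alternate, so the boundary joins either the two first terms or the two last
  terms of the direction 0 lists. Greedy remainders of equal weight cancel, and only the units
  placed at \<open>i\<close> and \<open>i + 1\<close> differ.\<close>

lemma close_consecutive_blocks:
  assumes k: "0 < k" and i: "gray_l k < i" "i < n" and c: "c i = 0"
  shows "close n (last (gen1_gray (add_at c 1 i) (k - 1) i (Suc m mod 2)))
                 (hd (gen1_gray (add_at c 1 (i + 1)) (k - 1) (i + 1) (m mod 2)))"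
proof -
  let ?x = "gen1_gray (add_at c 1 i) (k - 1) i 0"
  let ?y = "gen1_gray (add_at c 1 (i + 1)) (k - 1) (i + 1) 0"
  have i3: "i \<ge> 3" using gray_l_ge_2[OF k] i by simp
  have closeI: "close n x y"
    if "b \<in> {1, 2}" "\<And>j. int (y j) = int (x j) + (if j = i then - b else if j = i + 1 then b else 0)"
    for x y b
    unfolding close_def using that(1) i i3
    by (intro exI[of _ i] exI[of _ 0] exI[of _ b]) (auto simp: that(2))
  have hds: "close n (hd ?x) (hd ?y)"
    by (rule closeI[of 1]) (auto simp: hd_gray_0 add_at_def)
  have lasts: "close n (last ?x) (last ?y)"
  proof (cases "k = 1")
    case True
    then show ?thesis by (intro closeI[of 1]) (auto simp: add_at_def)
  next
    case False
    hence k1: "0 < k - 1" using k by simp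
    have l: "gray_l (k - 1) < i"
      using gray_l_le_iff[of "k - 1" "gray_l k"] le_tri_gray_l[of k] i by linarith
    \<comment> \<open>Since \<open>i \<ge> 3\<close>, a single unit does not fill entry
      \<open>i\<close>, so a second one may follow it there.\<close>
    have rx: "gray_r (add_at c 1 i) i = i" using c i3 by (simp add: gray_r_def add_at_def)
    define r' where "r' = gray_r (add_at c 1 (i + 1)) (i + 1)"
    have r': "r' = i \<or> r' = i + 1" by (auto simp: r'_def gray_r_def)
    have x: "last ?x = (\<lambda>j. add_at (add_at c 1 i) 1 i j + fill (k - 1 - 1) j)"
      using last_gray_0_far[OF k1, of "add_at c 1 i" i] l rx by simp
    have y: "last ?y = (\<lambda>j. add_at (add_at c 1 (i + 1)) 1 r' j + fill (k - 1 - 1) j)"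
      using last_gray_0_far[OF k1, of "add_at c 1 (i + 1)" "i + 1"] l r' unfolding r'_def by fastforce
    show ?thesis unfolding x y
      by (rule closeI[of "if r' = i then 1 else 2"]) (use r' in \<open>auto simp: add_at_def\<close>)
  qed
  show ?thesis
  proof (cases "even m")
    case True
    then show ?thesis using hds
      by (simp add: mod_Suc even_iff_mod_2_eq_zero gray_1_eq_rev[simplified] last_rev)
  next
    case False
    then show ?thesis using lasts
      by (simp add: mod_Suc odd_iff_mod_2_eq_one gray_1_eq_rev[simplified] hd_rev)
  qed
qed

lemma successively_concat_map_upt:
  assumes "\<And>i. a \<le> i \<Longrightarrow> i < b \<Longrightarrow> f i \<noteq> [] \<and> successively R (f i)"
    and "\<And>i. a \<le> i \<Longrightarrow> i + 1 < b \<Longrightarrow> R (last (f i)) (hd (f (i + 1)))"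
  shows "successively R (concat (map f [a..<b]))"
  using assms
proof (induction b)
  case (Suc b)
  show ?case
  proof (cases "a \<le> b")
    case True
    have IH: "successively R (concat (map f [a..<b]))" using Suc by simp
    show ?thesis
    proof (cases "a = b")
      case True
      then show ?thesis using Suc.prems by simp
    next
      case False
      then obtain b' where b': "b = Suc b'" "a \<le> b'" using True by (cases b) auto
      have "last (concat (map f [a..<b])) = last (f b')" "concat (map f [a..<b]) \<noteq> []"
        using Suc.prems(1)[of b'] b' by auto
      moreover have "concat (map f [a..<Suc b]) = concat (map f [a..<b]) @ f b"
        using True by simp
      moreover have "successively R (f b)" using Suc.prems(1)[of b] True by simp
      moreover have "R (last (f b')) (hd (f b))" using Suc.prems(2)[of b'] b' by simp
      ultimately show ?thesis using IH by (metis successively_append_iff)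
    qed
  qed simp
qed simp

lemma gray_mod_2_not_Nil: "gen1_gray c k r (m mod 2) \<noteq> []"
  by (rule gray_mod_2_cases[of c k r m]) auto

lemma successively_gray_mod_2:
  "successively (close n) (gen1_gray c k r 0) \<Longrightarrow> successively (close n) (gen1_gray c k r (m mod 2))"
  by (rule gray_mod_2_cases[of c k r m])
     (auto simp: successively_rev elim!: successively_mono intro: close_sym)

lemma successively_close_gray:
  "feasible c k r \<Longrightarrow> r \<le> n \<Longrightarrow> successively (close n) (gen1_gray c k r 0)"
proof (induction k arbitrary: c r rule: less_induct)
  case (less k)
  show ?case
  proof (cases "k = 0")
    case False
    hence k: "0 < k" by simp
    let ?l = "gray_l k" and ?r = "gray_r c r"
    let ?f = "\<lambda>i. gen1_gray (add_at c 1 i) (k - 1) i ((?r - i + 1) mod 2)"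
    let ?A = "gen1_gray (add_at c (gray_e k) ?l) (k - gray_e k) ?l 0"
    note le = feasible_gray_l_le[OF less.prems(1) k]
    have c0: "c j = 0" if "j < r" for j using less.prems(1) that by (simp add: feasible_def)
    have A: "successively (close n) ?A"
      using less.IH[OF _ feasible_step_l[OF less.prems(1) k]] gray_e_pos[OF k] k le less.prems(2)
      by simp
    have B: "successively (close n) (concat (map ?f [?l + 1..<?r + 1]))"
    proof (rule successively_concat_map_upt)
      fix i assume i: "?l + 1 \<le> i" "i < ?r + 1"
      have "successively (close n) (gen1_gray (add_at c 1 i) (k - 1) i 0)"
        using less.IH[OF _ feasible_step[OF less.prems(1) k, of i]] i k le less.prems(2) by simp
      then show "?f i \<noteq> [] \<and> successively (close n) (?f i)"
        using successively_gray_mod_2 gray_mod_2_not_Nil by blast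
    next
      fix i assume i: "?l + 1 \<le> i" "i + 1 < ?r + 1"
      have m: "?r - i + 1 = Suc (?r - (i + 1) + 1)" using i by simp
      show "close n (last (?f i)) (hd (?f (i + 1)))"
        unfolding m using i k le less.prems(2) c0[of i]
        by (intro close_consecutive_blocks) auto
    qed
    show ?thesis
    proof (cases "?l < ?r")
      case True
      have "[?l + 1..<?r + 1] = (?l + 1) # [?l + 2..<?r + 1]"
        using True by (subst upt_conv_Cons) auto
      hence "hd (concat (map ?f [?l + 1..<?r + 1])) = hd (?f (?l + 1))"
        using gray_mod_2_not_Nil by (simp del: upt_Suc)
      moreover have "close n (last ?A) (hd (?f (?l + 1)))"
        using True le less.prems(2) c0 by (intro close_first_second_block[OF k]) auto
      ultimately show ?thesis using A B unfolding gray_0[OF k] successively_append_iff by simp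
    next
      case False
      then show ?thesis using A unfolding gray_0[OF k] by simp
    qed
  qed simp
qed

theorem mainTheorem2:
  fixes n k :: nat and perms :: "(nat \<Rightarrow> nat) list"
  assumes "n \<ge> 1" and "k \<le> n * (n - 1) div 2"
    and "perms = map (psi n) (gen1_gray (\<lambda>_. 0) k n 0)"
  shows "set perms = {p. p permutes {1..n} \<and> major_index n p = k}
       \<and> distinct perms
       \<and> (\<forall>i. i + 1 < length perms \<longrightarrow>
              differ_by_at_most_transpositions n 3 (perms ! i) (perms ! (i + 1)))"
proof -
  let ?L = "gen1_gray (\<lambda>_. 0) k n 0"
  have "k \<le> tri n" unfolding tri_def by (rule assms(2))
  hence f: "feasible (\<lambda>_. 0) k n" by (simp add: feasible_def)
  have set: "set ?L = {x. subexcedant n x \<and> (\<forall>j>n. x j = 0) \<and> sum x {..n} = k}"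
    unfolding set_gray[OF f] by (simp add: completions_def)
  have "psi n ` set ?L = {p. p permutes {1..n} \<and> major_index n p = k}"
  proof (intro equalityI subsetI)
    fix p assume "p \<in> psi n ` set ?L"
    then obtain t where "subexcedant n t" "sum t {..n} = k" "p = psi n t"
      unfolding set by blast
    then show "p \<in> {p. p permutes {1..n} \<and> major_index n p = k}"
      using psi_permutes[of n t] major_index_psi[of n t] by blast
  next
    fix p assume p: "p \<in> {p. p permutes {1..n} \<and> major_index n p = k}"
    then obtain t where t: "subexcedant n t" "\<forall>j>n. t j = 0" "psi n t = p"
      using psi_surj[of p n] by blast
    then have "t \<in> set ?L" using p major_index_psi[OF t(1)] unfolding set by simp
    then show "p \<in> psi n ` set ?L" unfolding t(3)[symmetric] by (rule imageI)
  qed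
  moreover have "inj_on (psi n) (set ?L)"
  proof (rule inj_onI)
    fix x y assume xy: "x \<in> set ?L" "y \<in> set ?L" "psi n x = psi n y"
    \<comment> \<open>Up to \<open>n\<close> the entries agree by \<open>psi_inj\<close>; beyond
      \<open>n\<close> both sequences vanish.\<close>
    show "x = y"
    proof
      fix j show "x j = y j"
        using psi_inj[of n x y j] xy unfolding set mem_Collect_eq by (metis not_le)
    qed
  qed
  moreover have "differ_by_at_most_transpositions n 3 (psi n (?L ! i)) (psi n (?L ! (i + 1)))"
    if "i + 1 < length ?L" for i
  proof (rule close_imp_differ_by)
    show "close n (?L ! i) (?L ! (i + 1))"
      using successively_close_gray[OF f order_refl] that by (simp add: successively_conv_nth)
    have "?L ! i \<in> set ?L" "?L ! (i + 1) \<in> set ?L" using that by (auto intro!: nth_mem)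
    then show "subexcedant n (?L ! i)" "subexcedant n (?L ! (i + 1))"
      unfolding set by blast+
  qed
  ultimately show ?thesis
    unfolding assms(3) using distinct_gray[OF f] by (simp add: distinct_map)
qed

end
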